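(* Let $\mathcal{X}$ be a Cantor set and let $a, b$ be two homeomorphisms of $\mathcal{X}$ of period two generating a minimal action of the infinite dihedral group $D_\infty=\langle a,b\rangle$ on $\mathcal{X}$. Let $A$ be a fragmentation of $a$ and let $B$ be a fragmentation of $b$. Suppose that $\xi\in\mathcal{X}$ is a fixed point of $a$, and that for every $h\in A$ such that $h(\xi)=\xi$, the interior of the set of fixed points of $h$ accumulates on $\xi$. Then the group $\langle A\cup B\rangle$ of homeomorphisms of $\mathcal{X}$ is periodic.
   Context: An action by homeomorphisms is minimal if all its orbits are dense. A homeomorphism of period two is a non-identity homeomorphism whose square is the identity. A fragmentation of a homeomorphism $a$ of period two of $\mathcal{X}$ is a finite group $A$ of homeomorphisms of $\mathcal{X}$ such that (i) for all $h\in A$ and $\zeta\in\mathcal{X}$, either $h(\zeta)=\zeta$ or $h(\zeta)=a(\zeta)$; and (ii) for every $\zeta\in\mathcal{X}$ there exists $h\in A$ with $h(\zeta)=a(\zeta)$. A set accumulates on $\xi$ if every neighborhood of $\xi$ contains a point of the set different from $\xi$. $\langle A\cup B\rangle$ is the group of homeomorphisms of $\mathcal{X}$ generated by $A\cup B$. A group $G$ is periodic if for every $g\in G$ there exists $n\ge 1$ such that $g^n$ is the identity. *)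

theory Defs
  imports "HOL-Analysis.Analysis" "HOL-Algebra.Group_Action" "HOL-Algebra.Elementary_Groups"
begin

definition cantor_space :: "'a topology \<Rightarrow> bool" where
  "cantor_space X \<longleftrightarrow>
     X homeomorphic_space product_topology (\<lambda>_::nat. discrete_topology (UNIV :: bool set)) UNIV"

definition homeo_group :: "('a::topological_space \<Rightarrow> 'a) monoid" where
  "homeo_group = \<lparr>carrier = {f. homeomorphic_map euclidean euclidean f},
                  monoid.mult = (\<circ>), one = id\<rparr>"

lemma group_homeo_group: "group (homeo_group :: ('a::topological_space \<Rightarrow> 'a) monoid)"
proof (rule groupI)
  fix f :: "'a \<Rightarrow> 'a"
  assume "f \<in> carrier homeo_group"
  then obtain g where g: "homeomorphic_maps euclidean euclidean f g"
    by (auto simp: homeo_group_def homeomorphic_map_maps)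
  then have "homeomorphic_map euclidean euclidean g"
    using homeomorphic_maps_map by blast
  moreover have "g \<circ> f = id"
    using g by (auto simp: homeomorphic_maps_def)
  ultimately show "\<exists>g\<in>carrier homeo_group. g \<otimes>\<^bsub>homeo_group\<^esub> f = \<one>\<^bsub>homeo_group\<^esub>"
    by (auto simp: homeo_group_def)
qed (auto simp: homeo_group_def comp_assoc intro: homeomorphic_map_compose)

definition period_two :: "('a::topological_space \<Rightarrow> 'a) \<Rightarrow> bool" where
  "period_two f \<longleftrightarrow> f \<in> carrier homeo_group \<and> f \<noteq> id \<and> f \<circ> f = id"

text \<open>The infinite dihedral group, realised as the group of isometries of the integers:
  the translations and the reflections.\<close>

definition infinite_dihedral :: "(int \<Rightarrow> int) monoid" where
  "infinite_dihedral = \<lparr>carrier = {f. \<exists>c. f = (\<lambda>n. c + n) \<or> f = (\<lambda>n. c - n)},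
                        monoid.mult = (\<circ>), one = id\<rparr>"

lemma group_infinite_dihedral: "group infinite_dihedral"
proof (rule groupI)
  fix f
  assume "f \<in> carrier infinite_dihedral"
  then consider c where "f = (\<lambda>n. c + n)" | c where "f = (\<lambda>n. c - n)"
    by (auto simp: infinite_dihedral_def)
  then show "\<exists>g\<in>carrier infinite_dihedral. g \<otimes>\<^bsub>infinite_dihedral\<^esub> f = \<one>\<^bsub>infinite_dihedral\<^esub>"
  proof cases
    case (1 c)
    then show ?thesis
      by (intro bexI[of _ "\<lambda>n. - c + n"]) (auto simp: infinite_dihedral_def fun_eq_iff intro: exI[of _ "- c"])
  next
    case (2 c)
    then show ?thesis
      by (intro bexI[of _ "\<lambda>n. c - n"]) (auto simp: infinite_dihedral_def fun_eq_iff)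
  qed
next
  fix f g
  assume "f \<in> carrier infinite_dihedral" "g \<in> carrier infinite_dihedral"
  then obtain c d where "f = (\<lambda>n. c + n) \<or> f = (\<lambda>n. c - n)" "g = (\<lambda>n. d + n) \<or> g = (\<lambda>n. d - n)"
    by (auto simp: infinite_dihedral_def)
  then have "f \<circ> g \<in> {\<lambda>n. (c + d) + n, \<lambda>n. (c + d) - n, \<lambda>n. (c - d) - n, \<lambda>n. (c - d) + n}"
    by (auto simp: fun_eq_iff)
  then show "f \<otimes>\<^bsub>infinite_dihedral\<^esub> g \<in> carrier infinite_dihedral"
    unfolding infinite_dihedral_def by auto
next
  show "\<one>\<^bsub>infinite_dihedral\<^esub> \<in> carrier infinite_dihedral"
    by (auto simp: infinite_dihedral_def fun_eq_iff intro: exI[of _ 0])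
qed (auto simp: infinite_dihedral_def comp_assoc)

text \<open>\<^term>\<open>G\<close> is a group whose elements are themselves homeomorphisms, acting by evaluation.\<close>

definition minimal_homeo_action :: "('a::topological_space \<Rightarrow> 'a) monoid \<Rightarrow> bool" where
  "minimal_homeo_action G \<longleftrightarrow> (\<forall>x. closure (orbit G (\<lambda>g. g) x) = UNIV)"

definition fragmentation :: "('a::topological_space \<Rightarrow> 'a) \<Rightarrow> ('a \<Rightarrow> 'a) set \<Rightarrow> bool" where
  "fragmentation a A \<longleftrightarrow>
     finite A \<and> subgroup A homeo_group \<and>
     (\<forall>h\<in>A. \<forall>z. h z = z \<or> h z = a z) \<and>
     (\<forall>z. \<exists>h\<in>A. h z = a z)"

definition periodic_group :: "('g, 'r) monoid_scheme \<Rightarrow> bool" where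
  "periodic_group G \<longleftrightarrow> group G \<and> (\<forall>g\<in>carrier G. \<exists>n::nat. n \<ge> 1 \<and> g [^]\<^bsub>G\<^esub> n = \<one>\<^bsub>G\<^esub>)"

end

theory Submission
  imports Defs
begin

text \<open>
  Since \<open>a\<close> fixes \<open>\<xi>\<close>, the orbit of \<open>\<xi>\<close> under \<open>D\<^sub>\<infinity>\<close> is a ray \<open>\<xi>, b \<xi>, a b \<xi>, \<dots>\<close>,
  and reading a word of \<open>\<langle>A \<union> B\<rangle>\<close> periodically, letter by letter, moves a point of the ray by at most
  one place per letter.  Near a point \<open>\<zeta>\<close> close to \<open>\<xi>\<close> the orbit of \<open>\<zeta>\<close> looks like two copies of
  the ray glued at their origins, and a path passes from one copy to the other exactly when the
  product \<open>c\<close> of the letters of \<open>A\<close> read at the origin moves \<open>\<zeta>\<close>.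

  Suppose that some path through the origin of the ray is unbounded.  Up to periodicity there are only
  finitely many such paths.  Each of them has to cross the double ray around every far away \<open>\<zeta>\<close>
  in the orbit of \<open>\<xi>\<close>, and while doing so it follows such a path again; this defines an injection, hence a
  permutation, of the finite set of unbounded paths.  By hypothesis \<open>\<zeta>\<close> can be chosen to be fixed by the
  product \<open>c\<close> of a given path; that path is reflected at \<open>\<zeta>\<close>, so it is not in the
  image: a contradiction.  So all paths through the origin are bounded, points near \<open>\<xi>\<close> act
  as barriers, and by compactness and minimality these barriers occur with bounded gaps in all orbits.
\<close>

text \<open>Each \<open>f t\<close> is its own inverse, so the same maps that drive the recursion
  forward from \<open>t0\<close> also drive it backward; \<open>u\<close> and \<open>d\<close> are
  the two halves.\<close>

lemma int_orbit_exists: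
  fixes f :: "int \<Rightarrow> 's \<Rightarrow> 's"
  assumes "\<And>t z. f t (f t z) = z"
  shows "\<exists>x. x t0 = z \<and> (\<forall>t. x (t + 1) = f t (x t))"
proof -
  define u where "u = rec_nat z (\<lambda>k. f (t0 + int k))"
  define d where "d = rec_nat z (\<lambda>k. f (t0 - 1 - int k))"
  define x where "x t = (if t \<ge> t0 then u (nat (t - t0)) else d (nat (t0 - t)))" for t
  have "x (t + 1) = f t (x t)" for t
  proof (cases "t \<ge> t0")
    case True
    then have "nat (t + 1 - t0) = Suc (nat (t - t0))" by simp
    with True show ?thesis by (simp add: x_def u_def)
  next
    case False
    then have *: "nat (t0 - t) = Suc (nat (t0 - t - 1))" by simp
    have "x t = f t (d (nat (t0 - t - 1)))" using False
      by (simp add: x_def d_def *)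
    then have "f t (x t) = d (nat (t0 - t - 1))" using assms by simp
    moreover have "x (t + 1) = d (nat (t0 - t - 1))"
    proof (cases "t + 1 = t0")
      case True
      then show ?thesis by (simp add: x_def u_def d_def)
    next
      case neq: False
      then show ?thesis using False by (auto simp: x_def algebra_simps)
    qed
    ultimately show ?thesis by simp
  qed
  moreover have "x t0 = z" by (simp add: x_def u_def)
  ultimately show ?thesis by blast
qed

subsection \<open>Dihedral actions and their rays\<close>

locale dihedral_action =
  fixes a b :: "'a::topological_space \<Rightarrow> 'a"
  assumes compact_UNIV: "compact (UNIV :: 'a set)"
    and Hausdorff: "Hausdorff_space (euclidean :: 'a topology)"
    and infinite_UNIV: "infinite (UNIV :: 'a set)"
    and continuous_a: "continuous_on UNIV a"
    and continuous_b: "continuous_on UNIV b"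
    and a_a [simp]: "a (a x) = x"
    and b_b [simp]: "b (b x) = x"
    and minimal: "closed C \<Longrightarrow> C \<noteq> {} \<Longrightarrow> a ` C \<subseteq> C \<Longrightarrow> b ` C \<subseteq> C \<Longrightarrow> C = UNIV"
begin

definition gen :: "nat \<Rightarrow> 'a \<Rightarrow> 'a" where
  "gen k = (if even k then b else a)"

text \<open>The first letter is \<open>b\<close> because \<open>a\<close> is going to fix the origin
  of the ray. For general \<open>z\<close> the orbit consists of the walks from \<open>z\<close> and
  from \<open>a z\<close>, joined at their origins by \<open>a\<close>.\<close>

fun walk :: "nat \<Rightarrow> 'a \<Rightarrow> 'a" where
  "walk 0 z = z"
| "walk (Suc k) z = gen k (walk k z)"

lemma gen_gen [simp]: "gen k (gen k x) = x"
  by (simp add: gen_def)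

lemma gen_parity: "even i = even j \<Longrightarrow> gen i = gen j"
  by (simp add: gen_def)

lemma gen_walk: "gen k (walk k z) = walk (Suc k) z" "gen k (walk (Suc k) z) = walk k z"
  by simp_all

lemma walk_add: "even m \<Longrightarrow> walk k (walk m z) = walk (m + k) z"
proof (induction k)
  case (Suc k)
  then show ?case using gen_parity[of k "m + k"] by simp
qed simp

text \<open>For even \<open>m > 0\<close> the last letter of the walk to place \<open>m\<close> is
  \<open>a\<close>. Applying \<open>a\<close> undoes it, and the new walk then retraces the old one;
  hence the offset \<open>m - 1\<close>.\<close>

lemma walk_a_diff: "even m \<Longrightarrow> k < m \<Longrightarrow> walk k (a (walk m z)) = walk (m - 1 - k) z"
proof (induction k)
  case 0
  then obtain l where "m = Suc l" "odd l" by (cases m) auto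
  then show ?case using gen_walk(2)[of l z] by (simp add: gen_def)
next
  case (Suc k)
  then obtain l where l: "m = Suc (Suc k + l)" using less_imp_Suc_add by blast
  then have "gen k = gen l" using Suc.prems(1) by (intro gen_parity) auto
  with Suc l show ?case using gen_walk(2)[of l z] by simp
qed

text \<open>The excluded case is \<open>a\<close> at place \<open>0\<close>, where
  \<open>a z\<close> lies on the other walk and not on the one from \<open>z\<close>.\<close>

lemma walk_neighbour:
  assumes "c \<in> {a, b}" "k > 0 \<or> c = b"
  shows "\<exists>l. (l = Suc k \<or> k = Suc l) \<and> (\<forall>z. c (walk k z) = walk l z)"
proof (cases "c = gen k")
  case False
  then obtain l where l: "k = Suc l" using assms by (cases k) (auto simp: gen_def)
  then have "c = gen l" using assms False by (auto simp: gen_def split: if_splits)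
  with l show ?thesis by auto
next
  case True
  then show ?thesis by (intro exI[of _ "Suc k"]) simp
qed

section \<open>Walks: continuity, density and injectivity\<close>

lemma continuous_gen: "continuous_on UNIV (gen k)"
  by (simp add: gen_def continuous_a continuous_b)

lemma continuous_walk: "continuous_on UNIV (walk k)"
proof (induction k)
  case 0
  then show ?case by (simp add: continuous_on_id cong: continuous_on_cong)
next
  case (Suc k)
  have "continuous_on UNIV (\<lambda>z. gen k (walk k z))"
    by (rule continuous_on_compose2[OF continuous_gen Suc]) auto
  then show ?case by (simp cong: continuous_on_cong)
qed

lemma closed_eq:
  assumes "continuous_on UNIV f" "continuous_on UNIV (g :: 'a \<Rightarrow> 'a)"
  shows "closed {z. f z = g z}"
  using closedin_continuous_maps_eq[OF Hausdorff, of euclidean f g] assms by simp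

lemma finite_closed: "finite S \<Longrightarrow> closed (S :: 'a set)"
  using closedin_Hausdorff_finite[OF Hausdorff, of S] by simp

text \<open>The \<open>\<omega>\<close>-limit set of the sequence \<^term>\<open>walk k z\<close> is closed and invariant, because
  \<^term>\<open>a\<close> and \<^term>\<open>b\<close> shift this sequence by at most one.\<close>
lemma walk_meets:
  assumes "open V" "V \<noteq> {}"
  shows "\<exists>k. walk k z \<in> V"
proof -
  define T where "T m = (\<lambda>k. walk k z) ` {m..}" for m
  define C where "C = (\<Inter>m. closure (T m))"
  have "UNIV \<inter> (\<Inter>m\<in>UNIV. closure (T m)) \<noteq> {}"
  proof (rule compact_imp_fip_image[OF compact_UNIV])
    fix I :: "nat set"
    assume "finite I"
    then have "walk (Max (insert 0 I)) z \<in> T m" if "m \<in> I" for m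
      using that by (auto simp: T_def)
    then show "UNIV \<inter> (\<Inter>m\<in>I. closure (T m)) \<noteq> {}"
      using closure_subset by blast
  qed auto
  moreover have "c ` C \<subseteq> C" if c: "c \<in> {a, b}" for c
  proof -
    have "c ` T (Suc m) \<subseteq> T m" for m
    proof (intro subsetI, elim imageE)
      fix y x
      assume "y = c x" "x \<in> T (Suc m)"
      then obtain k where "y = c (walk k z)" "k \<ge> Suc m" by (auto simp: T_def)
      moreover from this obtain l where "l = Suc k \<or> k = Suc l" "c (walk k z) = walk l z"
        using walk_neighbour[OF c, of k] by auto
      ultimately show "y \<in> T m" by (auto simp: T_def simp del: walk.simps)
    qed
    then have "c ` closure (T (Suc m)) \<subseteq> closure (T m)" for m
      using c continuous_a continuous_b
      by (intro image_closure_subset)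
        (auto intro: continuous_on_subset closure_subset[THEN subsetD])
    then show ?thesis unfolding C_def by blast
  qed
  moreover have "closed C" by (auto simp: C_def)
  ultimately have "C = UNIV" by (intro minimal) (auto simp: C_def)
  then have "closure (T 0) = UNIV" by (auto simp: C_def)
  then have "V \<inter> T 0 \<noteq> {}" using assms open_Int_closure_eq_empty[of V "T 0"] by auto
  then show ?thesis by (auto simp: T_def)
qed

text \<open>By density the preimages of \<open>V\<close> under the walks form an open cover; a
  finite subcover bounds the waiting time uniformly in \<open>z\<close>.\<close>

lemma walk_meets_bounded:
  assumes "open V" "V \<noteq> {}"
  shows "\<exists>K. \<forall>z. \<exists>k\<le>K. walk k z \<in> V"
proof -
  have "open (walk k -` V)" for k
    using continuous_on_open_vimage[of UNIV "walk k"] continuous_walk assms(1) by auto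
  moreover have "UNIV \<subseteq> (\<Union>k\<in>UNIV. walk k -` V)"
    using walk_meets[OF assms] by blast
  ultimately obtain I where I: "finite I" "UNIV \<subseteq> (\<Union>k\<in>I. walk k -` V)"
    using compactE_image[OF compact_UNIV, of UNIV "\<lambda>k. walk k -` V"] by auto
  have "\<exists>k\<le>Max I. walk k z \<in> V" for z
  proof -
    obtain k where "k \<in> I" "walk k z \<in> V" using I(2) by blast
    then show ?thesis using I(1) by (intro exI[of _ k]) auto
  qed
  then show ?thesis by blast
qed

text \<open>If the ray stopped, its initial piece would be a finite, hence closed, nonempty
  invariant set, so by minimality the whole infinite space.\<close>

lemma walk_Suc_neq:
  assumes "a \<xi> = \<xi>"
  shows "walk (Suc k) \<xi> \<noteq> walk k \<xi>"
proof
  assume stop: "walk (Suc k) \<xi> = walk k \<xi>"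
  define C where "C = (\<lambda>j. walk j \<xi>) ` {..k}"
  have "c ` C \<subseteq> C" if c: "c \<in> {a, b}" for c
  proof (intro subsetI, elim imageE)
    fix y x
    assume "y = c x" "x \<in> C"
    then obtain j where y: "y = c (walk j \<xi>)" "j \<le> k" by (auto simp: C_def)
    show "y \<in> C"
    proof (cases "j = 0 \<and> c = a")
      case False
      then obtain l where "l = Suc j \<or> j = Suc l" "y = walk l \<xi>"
        using walk_neighbour[OF c, of j] c y(1) by auto
      then have "y = walk (if l = Suc k then k else l) \<xi>" "l \<le> Suc k"
        using stop y(2) by (auto simp del: walk.simps)
      then show ?thesis unfolding C_def by (intro image_eqI) auto
    qed (use y assms in \<open>auto simp: C_def intro!: image_eqI[of _ _ 0]\<close>)
  qed
  then have "C = UNIV" by (intro minimal) (auto simp: C_def finite_closed)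
  moreover have "finite C" by (simp add: C_def)
  ultimately show False using infinite_UNIV by simp
qed

text \<open>A coincidence at odd distance has the same letter at both ends; cancelling it shortens
  the loop until two consecutive places coincide. A coincidence at even distance can be pushed down
  the ray to the origin by cancelling the common last letter; there the last letter of the longer
  walk is \<open>a\<close>, which fixes \<xi>, and this leaves a coincidence at odd
  distance.\<close>

lemma inj_walk:
  assumes "a \<xi> = \<xi>"
  shows "inj (\<lambda>k. walk k \<xi>)"
proof -
  have even_gap: "walk (i + d + 1) \<xi> \<noteq> walk i \<xi>" if "even d" for i d
    using that
  proof (induction d arbitrary: i rule: less_induct)
    case (less d)
    show ?case
    proof (cases "d = 0")
      case True
      then show ?thesis using walk_Suc_neq[OF assms, of i] by simp
    next
      case False
      then have "2 \<le> d" using less.prems by (cases "d = 1") auto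
      define e where "e = d - 2"
      with less.prems \<open>2 \<le> d\<close> have e: "d = e + 2" "even e" by auto
      show ?thesis
      proof
        assume eq: "walk (i + d + 1) \<xi> = walk i \<xi>"
        have "gen i = gen (i + d)" using less.prems by (intro gen_parity) auto
        then have "walk (Suc i + e + 1) \<xi> = walk (Suc i) \<xi>"
          using eq gen_walk(2)[of "i + d" \<xi>] e by simp
        then show False using less.IH[of e "Suc i"] e by simp
      qed
    qed
  qed
  have "walk (i + d + 1) \<xi> \<noteq> walk i \<xi>" if d: "odd d" for i d
  proof (induction i)
    case 0
    obtain e where "d = Suc e" using d by (cases d) auto
    with d have e: "d = Suc e" "even e" by auto
    show ?case
    proof
      assume eq: "walk (0 + d + 1) \<xi> = walk 0 \<xi>"
      then have "walk (Suc d) \<xi> = \<xi>" by (simp del: walk.simps(2))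
      moreover have "gen d = a" using d by (simp add: gen_def)
      ultimately have "walk d \<xi> = \<xi>" using gen_walk(2)[of d \<xi>] assms by metis
      then have "walk (0 + e + 1) \<xi> = walk 0 \<xi>" using e by (simp del: walk.simps(2))
      then show False using even_gap[OF e(2), of 0] by simp
    qed
  next
    case (Suc i)
    have "gen (i + d + 1) = gen i" using d by (intro gen_parity) auto
    then show ?case using Suc gen_walk(2)[of i \<xi>] gen_walk(2)[of "i + d + 1" \<xi>]
      by (metis add_Suc Suc_eq_plus1)
  qed
  with even_gap have *: "walk (i + d + 1) \<xi> \<noteq> walk i \<xi>" for i d by blast
  show ?thesis
  proof (rule injI, rule ccontr)
    fix i j :: nat
    assume eq: "walk i \<xi> = walk j \<xi>" and "i \<noteq> j"
    then consider d where "j = i + d + 1" | d where "i = j + d + 1"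
      by (metis Suc_eq_plus1 add_Suc_right less_imp_Suc_add nat_neq_iff)
    then show False using eq * by cases metis+
  qed
qed

declare walk.simps(2) [simp del]

end

subsection \<open>Fragmentations near the fixed point\<close>

text \<open>As \<open>a\<close> fixes \<xi>, so does every element of \<open>A\<close>; therefore
  accumulation is stated for all of \<open>A\<close>.\<close>

locale fragmented_action = dihedral_action +
  fixes A B :: "('a \<Rightarrow> 'a) set" and \<xi> :: 'a
  assumes finite_A: "finite A" and finite_B: "finite B"
    and id_A: "id \<in> A"
    and comp_A: "h \<in> A \<Longrightarrow> k \<in> A \<Longrightarrow> h \<circ> k \<in> A"
    and continuous_letter: "s \<in> A \<union> B \<Longrightarrow> continuous_on UNIV s"
    and inj_letter: "s \<in> A \<union> B \<Longrightarrow> inj s"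
    and A_cases: "s \<in> A \<Longrightarrow> s z = z \<or> s z = a z"
    and B_cases: "s \<in> B \<Longrightarrow> s z = z \<or> s z = b z"
    and A_covers: "\<exists>h\<in>A. h z = a z"
    and a_fixes [simp]: "a \<xi> = \<xi>"
    and accumulates: "h \<in> A \<Longrightarrow> \<xi> islimpt interior {x. h x = x}"
begin

lemma letter_cases:
  assumes "s \<in> A \<union> B"
  shows "\<exists>c. c \<in> {a, b} \<and> (\<forall>z. s z = z \<or> s z = c z) \<and> (s \<in> A \<longrightarrow> c = a) \<and> (s \<notin> A \<longrightarrow> c = b)"
proof (cases "s \<in> A")
  case True
  with A_cases[OF True] show ?thesis by blast
next
  case False
  with assms have "s \<in> B" by blast
  with B_cases[OF this] False show ?thesis by blast
qed

text \<open>An injective map that sends every point to itself or to its \<open>c\<close>-image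
  preserves each pair formed by \<open>z\<close> and \<open>c z\<close>, so it is the identity or
  the swap there.\<close>

lemma letter_involution:
  assumes "s \<in> A \<union> B"
  shows "s (s z) = z"
proof -
  obtain c where c: "c \<in> {a, b}" "\<And>z. s z = z \<or> s z = c z" using letter_cases[OF assms] by blast
  then have cc: "c (c z) = z" by auto
  from c(2)[of z] show ?thesis
  proof
    assume "s z = c z"
    then show ?thesis
      using c(2)[of "c z"] cc inj_eq[OF inj_letter[OF assms], of "c z" z] by (elim disjE) simp_all
  qed simp
qed

lemma A_fixes: "h \<in> A \<Longrightarrow> h \<xi> = \<xi>"
  using A_cases[of h \<xi>] a_fixes by metis

text \<open>This allows a fixed point at an odd place of the ray to be traded for its
  \<open>a\<close>-neighbour at an even place.\<close>

lemma A_fixes_a: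
  assumes "h \<in> A" "h z = z"
  shows "h (a z) = a z"
proof -
  have "inj h" using assms(1) inj_letter by blast
  from A_cases[OF assms(1), of "a z"] show ?thesis
  proof
    assume "h (a z) = a (a z)"
    then have "h (a z) = h z" using assms(2) by simp
    then have "a z = z" by (rule injD[OF \<open>inj h\<close>])
    then show ?thesis using assms(2) by simp
  qed
qed

lemma walk_xi_eq_iff [simp]: "walk i \<xi> = walk j \<xi> \<longleftrightarrow> i = j"
  using inj_eq[OF inj_walk[OF a_fixes]] .

lemma letter_step:
  assumes "s \<in> A \<union> B"
  shows "\<exists>l. s (walk k \<xi>) = walk l \<xi> \<and> l \<le> Suc k \<and> k \<le> Suc l \<and> (k = 0 \<and> s \<in> A \<longrightarrow> l = 0)"
proof -
  obtain c where c: "c \<in> {a, b}" "\<forall>z. s z = z \<or> s z = c z" "s \<in> A \<longrightarrow> c = a" "s \<notin> A \<longrightarrow> c = b"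
    using letter_cases[OF assms] by - (elim exE conjE, rule that)
  show ?thesis
  proof (cases "k = 0 \<and> s \<in> A")
    case False
    then have "k > 0 \<or> c = b" using c(4) by auto
    then obtain l where "l = Suc k \<or> k = Suc l" "c (walk k \<xi>) = walk l \<xi>"
      using walk_neighbour[OF c(1), of k] by blast
    with c(2)[THEN spec, of "walk k \<xi>"] have "\<exists>j\<in>{k, l}. s (walk k \<xi>) = walk j \<xi>" by simp
    then obtain j where "s (walk k \<xi>) = walk j \<xi>" "j = k \<or> j = l" by blast
    moreover from this \<open>l = Suc k \<or> k = Suc l\<close> have "j \<le> Suc k \<and> k \<le> Suc j" by auto
    ultimately show ?thesis using False by blast
  next
    case True
    then have "s (walk k \<xi>) = walk 0 \<xi>" using A_fixes by simp
    with True show ?thesis by blast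
  qed
qed

text \<open>A letter has only two possible values at \<open>walk k z\<close>, and at \<xi> these
  differ. The set where it takes the other value than at \<xi> is closed and misses \<xi>.\<close>

lemma letter_step_nbhd:
  assumes s: "s \<in> A \<union> B" and "\<not> (k = 0 \<and> s \<in> A)"
  shows "\<exists>V. open V \<and> \<xi> \<in> V \<and>
    (\<forall>z\<in>V. \<forall>l. s (walk k \<xi>) = walk l \<xi> \<longrightarrow> s (walk k z) = walk l z)"
proof -
  obtain c where c: "c \<in> {a, b}" "\<forall>z. s z = z \<or> s z = c z" "s \<notin> A \<longrightarrow> c = b"
    using letter_cases[OF s] by - (elim exE conjE, rule that)
  have "k > 0 \<or> c = b" using assms(2) c(3) by auto
  then obtain m where m: "m \<noteq> k" "\<And>z. c (walk k z) = walk m z"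
    using walk_neighbour[OF c(1), of k] by (metis n_not_Suc_n)
  have cont: "continuous_on UNIV (\<lambda>z. s (walk k z))"
    by (rule continuous_on_compose2[OF continuous_letter[OF s] continuous_walk]) auto
  \<comment> \<open>\<open>j\<close> is the place that the letter does not choose at \<xi>.\<close>
  define j where "j = (if s (walk k \<xi>) = walk k \<xi> then m else k)"
  have s_walk: "s (walk k z) = walk k z \<or> s (walk k z) = walk m z" for z
    using c(2)[THEN spec, of "walk k z"] m(2) by simp
  define V where "V = - {z. s (walk k z) = walk j z}"
  have "open V" unfolding V_def
    using closed_eq[OF cont continuous_walk] by auto
  moreover have "\<xi> \<in> V"
    using m(1) by (simp add: V_def j_def del: walk.simps)
  moreover have "s (walk k z) = walk l z" if z: "z \<in> V" and l: "s (walk k \<xi>) = walk l \<xi>" for z l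
  proof (cases "s (walk k \<xi>) = walk k \<xi>")
    case True
    then have "l = k" using l by simp
    moreover have "s (walk k z) \<noteq> walk m z" using z True by (simp add: V_def j_def)
    ultimately show ?thesis using s_walk[of z] by simp
  next
    case False
    then have "l = m" using l s_walk[of \<xi>] by simp
    moreover have "s (walk k z) \<noteq> walk k z" using z False by (simp add: V_def j_def)
    ultimately show ?thesis using s_walk[of z] by simp
  qed
  ultimately show ?thesis by blast
qed

text \<open>On a window the letters act on the walk from any \<open>z \<in> U\<close> as on the ray of \<open>\<xi>\<close>, except that
  a letter of \<^term>\<open>A\<close> at place \<open>0\<close>, which fixes \<open>\<xi>\<close>, may replace \<open>z\<close> by \<open>a z\<close>.\<close>
definition window :: "nat \<Rightarrow> 'a set \<Rightarrow> bool" where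
  "window N U \<longleftrightarrow> open U \<and> \<xi> \<in> U \<and> (\<forall>h\<in>A. \<forall>z\<in>U. h z \<in> U) \<and>
     (\<forall>z\<in>U. \<forall>k\<le>N. \<forall>s\<in>A \<union> B. \<forall>l. \<not> (k = 0 \<and> s \<in> A) \<longrightarrow>
        s (walk k \<xi>) = walk l \<xi> \<longrightarrow> s (walk k z) = walk l z)"

lemma window_exists: "\<exists>U. window N U"
proof -
  define good where "good k s z \<longleftrightarrow>
    (\<forall>l. \<not> (k = 0 \<and> s \<in> A) \<longrightarrow> s (walk k \<xi>) = walk l \<xi> \<longrightarrow> s (walk k z) = walk l z)" for k s z
  have ex: "\<exists>V. open V \<and> \<xi> \<in> V \<and> (\<forall>z\<in>V. good k s z)" if "s \<in> A \<union> B" for k s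
  proof (cases "k = 0 \<and> s \<in> A")
    case True
    then show ?thesis by (intro exI[of _ UNIV]) (simp add: good_def)
  next
    case False
    then show ?thesis using letter_step_nbhd[OF that False] by (simp add: good_def)
  qed
  define V where "V k s = (SOME V. open V \<and> \<xi> \<in> V \<and> (\<forall>z\<in>V. good k s z))" for k s
  have V: "open (V k s) \<and> \<xi> \<in> V k s \<and> (\<forall>z\<in>V k s. good k s z)" if "s \<in> A \<union> B" for k s
    unfolding V_def by (rule someI_ex) (rule ex[OF that])
  define W where "W = (\<Inter>k\<in>{..N}. \<Inter>s\<in>A \<union> B. V k s)"
  \<comment> \<open>Closure of \<open>A\<close> under composition makes this intersection
    \<open>A\<close>-invariant, and \<open>id \<in> A\<close> puts it inside
    \<open>W\<close>.\<close>
  define U where "U = (\<Inter>h\<in>A. h -` W)"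
  have "open W" unfolding W_def
    by (intro open_INT ballI V[THEN conjunct1]) (simp_all add: finite_A finite_B)
  then have U: "open U" unfolding U_def
    using continuous_letter by (intro open_INT finite_A ballI open_vimage) blast+
  have xi: "\<xi> \<in> U"
  proof -
    have "\<xi> \<in> W" unfolding W_def using V by blast
    then show ?thesis by (simp add: U_def A_fixes)
  qed
  have inv: "h z \<in> U" if "h \<in> A" "z \<in> U" for h z
    unfolding U_def
  proof (intro INT_I vimageI2)
    fix k assume "k \<in> A"
    then have "k \<circ> h \<in> A" using that(1) by (rule comp_A)
    then have "(k \<circ> h) z \<in> W" using that(2) unfolding U_def by blast
    then show "k (h z) \<in> W" by simp
  qed
  have local_rule: "good k s z" if "z \<in> U" "k \<le> N" "s \<in> A \<union> B" for z k s
  proof -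
    have "id z \<in> W" using that(1) id_A unfolding U_def by blast
    then have "z \<in> V k s" using that(2,3) unfolding W_def by simp
    then show ?thesis using V[OF that(3)] by blast
  qed
  have "window N U" unfolding window_def
  proof (intro conjI ballI allI impI)
    fix z k s l
    assume "z \<in> U" "k \<le> N" "s \<in> A \<union> B" and "\<not> (k = 0 \<and> s \<in> A)" "s (walk k \<xi>) = walk l \<xi>"
    then show "s (walk k z) = walk l z"
      using local_rule[of z k s] unfolding good_def by blast
  qed (fact U xi inv)+
  then show ?thesis ..
qed

lemma window_a: "window N U \<Longrightarrow> z \<in> U \<Longrightarrow> a z \<in> U"
  using A_covers[of z] by (metis window_def)

end

subsection \<open>Paths along the ray\<close>

text \<open>A word of length \<open>n\<close> is repeated periodically over all integer times, so
  that paths can be followed both forward and backward.\<close>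

locale fragmented_word = fragmented_action +
  fixes v :: "int \<Rightarrow> 'a \<Rightarrow> 'a" and n :: int
  assumes letters: "v t \<in> A \<union> B" and v_periodic: "v (t + n) = v t" and n_pos: "n > 0"
begin

text \<open>The letter \<open>v t\<close>, transported to the places of the ray; this makes sense
  because letters preserve the ray and its places are distinct.\<close>

definition step :: "int \<Rightarrow> nat \<Rightarrow> nat" where
  "step t k = inv_into UNIV (\<lambda>k. walk k \<xi>) (v t (walk k \<xi>))"

lemma step_props:
  "walk (step t k) \<xi> = v t (walk k \<xi>)" "step t k \<le> Suc k" "k \<le> Suc (step t k)"
  "v t \<in> A \<Longrightarrow> step t 0 = 0"
proof -
  obtain l where l: "v t (walk k \<xi>) = walk l \<xi>" "l \<le> Suc k" "k \<le> Suc l" "k = 0 \<and> v t \<in> A \<longrightarrow> l = 0"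
    using letter_step[OF letters, of t k] by metis
  have "step t k = l" by (simp add: step_def l inv_f_f[OF inj_walk[OF a_fixes]])
  with l show "walk (step t k) \<xi> = v t (walk k \<xi>)" "step t k \<le> Suc k" "k \<le> Suc (step t k)"
    by simp_all
next
  assume "v t \<in> A"
  then have "v t \<xi> = \<xi>" by (rule A_fixes)
  then show "step t 0 = 0"
    using inv_f_f[OF inj_walk[OF a_fixes], of 0] by (simp add: step_def)
qed

lemma step_involution: "step t (step t k) = k"
proof -
  have "walk (step t (step t k)) \<xi> = walk k \<xi>"
    by (simp only: step_props(1) letter_involution[OF letters])
  then show ?thesis by simp
qed

lemma v_shift: "v (t + m * n) = v t"
proof (induction m rule: int_induct[of _ 0])
  case (step1 m)
  then show ?case using v_periodic[of "t + m * n"] by (simp add: algebra_simps)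
next
  case (step2 m)
  then show ?case using v_periodic[of "t + (m - 1) * n"] by (simp add: algebra_simps)
qed simp

definition ray_path :: "(int \<Rightarrow> nat) \<Rightarrow> bool" where
  "ray_path y \<longleftrightarrow> (\<forall>t. y (t + 1) = step t (y t))"

lemma ray_path_exists: "\<exists>y. ray_path y \<and> y t = k"
  using int_orbit_exists[of step t k] step_involution by (auto simp: ray_path_def)

lemma ray_path_step: "ray_path y \<Longrightarrow> y (t + 1) \<le> Suc (y t)" "ray_path y \<Longrightarrow> y t \<le> Suc (y (t + 1))"
  by (simp_all add: ray_path_def step_props)

lemma ray_path_unique:
  assumes "ray_path x" "ray_path y" "x t = y t"
  shows "x = y"
proof
  fix s
  show "x s = y s"
  proof (induction s rule: int_induct[of _ t])
    case (step2 i)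
    then have "step (i - 1) (x (i - 1)) = step (i - 1) (y (i - 1))"
      using assms(1,2) unfolding ray_path_def by (metis diff_add_cancel)
    then show ?case by (metis step_involution)
  qed (use assms in \<open>auto simp: ray_path_def\<close>)
qed

lemma ray_path_shift:
  assumes "ray_path y"
  shows "ray_path (\<lambda>t. y (t + m * n))"
proof -
  have "step (t + m * n) = step t" for t by (simp add: step_def v_shift fun_eq_iff)
  then show ?thesis using assms unfolding ray_path_def
    by (metis add.commute add.left_commute)
qed

definition recurrent :: "(int \<Rightarrow> nat) \<Rightarrow> bool" where
  "recurrent y \<longleftrightarrow> (\<exists>p>0. \<forall>t m. y (t + m * p) = y t)"

text \<open>A path is determined by its place together with the time modulo \<open>n\<close>. If
  such a pair repeats, the path is periodic; otherwise the pairs are all distinct, and only finitely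
  many of them have place at most \<open>K\<close>.\<close>

lemma recurrent_or_proper:
  assumes "ray_path y"
  shows "recurrent y \<or> finite {t. y t \<le> K}"
proof (cases "\<exists>t m. m > 0 \<and> y (t + m * n) = y t")
  case True
  then obtain t m where m: "m > 0" "y (t + m * n) = y t" by blast
  have period: "y (s + m * n) = y s" for s
    using ray_path_unique[OF ray_path_shift[OF assms, of m] assms, of t] m(2) by (simp add: fun_eq_iff)
  have "y (s + j * (m * n)) = y s" for s j
  proof (induction j rule: int_induct[of _ 0])
    case (step1 j)
    then show ?case using period[of "s + j * (m * n)"] by (simp add: algebra_simps)
  next
    case (step2 j)
    then show ?case using period[of "s + (j - 1) * (m * n)"] by (simp add: algebra_simps)
  qed simp
  then show ?thesis using m(1) n_pos unfolding recurrent_def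
    by (intro disjI1 exI[of _ "m * n"]) auto
next
  case False
  have "inj (\<lambda>t. (y t, t mod n))"
  proof (rule linorder_injI)
    fix s t :: int
    assume "s < t"
    show "(y s, s mod n) \<noteq> (y t, t mod n)"
    proof
      assume eq: "(y s, s mod n) = (y t, t mod n)"
      then have "n dvd t - s" by (auto simp: mod_eq_dvd_iff dvd_diff_commute)
      then obtain m where "t = s + m * n" by (metis add_diff_cancel_left' diff_add_cancel dvdE mult.commute add.commute)
      moreover from this \<open>s < t\<close> n_pos have "m > 0" by (simp add: zero_less_mult_iff)
      moreover have "y t = y s" using eq by simp
      ultimately show False using False by metis
    qed
  qed
  moreover have "(\<lambda>t. (y t, t mod n)) ` {t. y t \<le> K} \<subseteq> {..K} \<times> {0..<n}"
    using n_pos by auto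
  ultimately show ?thesis
    by (meson finite_SigmaI finite_atLeastLessThan_int finite_atMost finite_imageD finite_subset
        inj_on_subset subset_UNIV)
qed

section \<open>Excursions between visits to the origin\<close>

lemma bounded_excursions_of:
  assumes "ray_path y"
  shows "\<exists>N. \<forall>t t1 t2. y t1 = 0 \<longrightarrow> y t2 = 0 \<longrightarrow> t1 \<le> t \<longrightarrow> t \<le> t2 \<longrightarrow> y t \<le> N"
proof (cases "recurrent y")
  case True
  then obtain p where p: "p > 0" "\<And>t m. y (t + m * p) = y t" by (auto simp: recurrent_def)
  have "y t \<le> Max (y ` {0..<p})" for t
  proof -
    have "y t = y (t mod p)" using p(2)[of "t mod p" "t div p"] by simp
    then show ?thesis using p(1) by (intro Max_ge) auto
  qed
  then show ?thesis by blast
next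
  case False
  \<comment> \<open>A path that is not recurrent visits the origin finitely often, so all times
    between two visits lie in the finite interval \<open>J\<close>.\<close>
  define Z where "Z = {t. y t \<le> 0}"
  define J where "J = {Min Z..Max Z}"
  have "finite Z" using recurrent_or_proper[OF assms, of 0] False by (simp add: Z_def)
  have "t \<in> J" if "y t1 = 0" "y t2 = 0" "t1 \<le> t" "t \<le> t2" for t t1 t2
  proof -
    have "t1 \<in> Z" "t2 \<in> Z" using that by (auto simp: Z_def)
    then have "Min Z \<le> t1" "t2 \<le> Max Z" using \<open>finite Z\<close> by auto
    then show ?thesis using that by (simp add: J_def)
  qed
  moreover have "y t \<le> Max (y ` J)" if "t \<in> J" for t
    using that by (intro Max_ge) (auto simp: J_def)
  ultimately show ?thesis by blast
qed

text \<open>Up to a shift by a multiple of \<open>n\<close>, a path through the origin is determined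
  by the residue of a visiting time. Hence finitely many bounds have to be combined.\<close>

lemma bounded_excursions:
  "\<exists>N. \<forall>y t t1 t2. ray_path y \<longrightarrow> y t1 = 0 \<longrightarrow> y t2 = 0 \<longrightarrow> t1 \<le> t \<longrightarrow> t \<le> t2 \<longrightarrow> y t \<le> N"
proof -
  have "\<exists>N. \<forall>y t t1 t2. ray_path y \<longrightarrow> y i = 0 \<longrightarrow> y t1 = 0 \<longrightarrow> y t2 = 0 \<longrightarrow> t1 \<le> t \<longrightarrow> t \<le> t2 \<longrightarrow> y t \<le> N"
    for i
    using ray_path_exists[of i 0] bounded_excursions_of ray_path_unique by metis
  then obtain N where N: "\<And>i y t t1 t2. ray_path y \<Longrightarrow> y i = 0 \<Longrightarrow> y t1 = 0 \<Longrightarrow> y t2 = 0 \<Longrightarrow>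
      t1 \<le> t \<Longrightarrow> t \<le> t2 \<Longrightarrow> y t \<le> N i"
    by metis
  have "y t \<le> Max (N ` {0..<n})"
    if "ray_path y" "y t1 = 0" "y t2 = 0" "t1 \<le> t" "t \<le> t2" for y t t1 t2
  proof -
    define m where "m = t1 div n"
    have "y (t - m * n + m * n) \<le> N (t1 mod n)"
      by (rule N[OF ray_path_shift[OF that(1), of m], of _ "t1 - m * n" "t2 - m * n"])
        (use that in \<open>auto simp: m_def\<close>)
    then have "y t \<le> N (t1 mod n)" by simp
    also have "\<dots> \<le> Max (N ` {0..<n})" using n_pos by (intro Max_ge) auto
    finally show ?thesis .
  qed
  then show ?thesis by blast
qed

section \<open>Lifting paths from the ray to nearby double rays\<close>

definition switch :: "(int \<Rightarrow> nat) \<Rightarrow> int \<Rightarrow> 'a \<Rightarrow> 'a" where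
  "switch y t = (if y t = 0 \<and> v t \<in> A then v t else id)"

text \<open>Letters of \<open>A\<close> read at the origin leave the place of the path at
  \<open>0\<close> but act on the base point of a nearby walk. \<open>transit\<close> is their
  product over \<open>m\<close> steps, which tells on which sheet the lifted path runs.\<close>

fun transit :: "(int \<Rightarrow> nat) \<Rightarrow> int \<Rightarrow> nat \<Rightarrow> 'a \<Rightarrow> 'a" where
  "transit y t 0 = id"
| "transit y t (Suc m) = switch y (t + int m) \<circ> transit y t m"

lemma transit_A: "transit y t m \<in> A"
proof (induction m)
  case (Suc m)
  have "switch y (t + int m) \<in> A" by (simp add: switch_def id_A)
  then show ?case unfolding transit.simps by (rule comp_A[OF _ Suc])
qed (simp only: transit.simps id_A)

lemma transit_add: "transit y t (m + k) = transit y (t + int m) k \<circ> transit y t m"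
  by (induction k) (simp_all add: fun_eq_iff algebra_simps)

lemma transit_id: "(\<And>j. j < m \<Longrightarrow> y (t + int j) \<noteq> 0) \<Longrightarrow> transit y t m = id"
proof (induction m)
  case (Suc m)
  have "transit y t m = id" by (rule Suc.IH) (rule Suc.prems, simp)
  moreover have "switch y (t + int m) = id" using Suc.prems[of m] by (simp add: switch_def)
  ultimately show ?case by (simp only: transit.simps id_o)
qed simp

lemma transit_shift: "transit (\<lambda>s. y (s + m * n)) t k = transit y (t + m * n) k"
proof (induction k)
  case (Suc k)
  have "v (t + m * n + int k) = v (t + int k)" using v_shift[of "t + int k" m] by (simp add: algebra_simps)
  with Suc show ?case by (simp add: switch_def algebra_simps)
qed simp

text \<open>Away from letters of \<open>A\<close> at the origin, the window copies the steps of the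
  ray; at the origin such a letter goes into \<open>transit\<close>. The base point remains in
  \<open>U\<close> because \<open>U\<close> is \<open>A\<close>-invariant.\<close>

lemma lift_path:
  assumes "window N U" "\<zeta> \<in> U" "ray_path y"
    and x: "\<And>t. t \<ge> t0 \<Longrightarrow> x (t + 1) = v t (x t)" "x t0 = walk (y t0) \<zeta>"
    and "\<And>j. j < m \<Longrightarrow> y (t0 + int j) \<le> N"
  shows "x (t0 + int m) = walk (y (t0 + int m)) (transit y t0 m \<zeta>)"
  using assms(6)
proof (induction m)
  case 0
  then show ?case using x(2) by simp
next
  case (Suc m)
  define t where "t = t0 + int m"
  define z where "z = transit y t0 m \<zeta>"
  have z: "z \<in> U" using assms(1,2) transit_A unfolding z_def window_def by blast
  have "x (t + 1) = v t (walk (y t) z)"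
    using Suc x(1)[of t] by (simp add: t_def z_def)
  also have "\<dots> = walk (y (t + 1)) (transit y t0 (Suc m) \<zeta>)"
  proof (cases "y t = 0 \<and> v t \<in> A")
    case True
    then have "y (t + 1) = 0" using assms(3) step_props(4)[of t] by (simp add: ray_path_def)
    with True show ?thesis by (simp add: switch_def t_def[symmetric] z_def)
  next
    case False
    have "v t (walk (y t) \<xi>) = walk (y (t + 1)) \<xi>"
      using assms(3) by (simp add: ray_path_def step_props(1))
    moreover have "y t \<le> N" using Suc.prems[of m] by (simp add: t_def)
    ultimately have "v t (walk (y t) z) = walk (y (t + 1)) z"
      using assms(1) z letters[of t] False unfolding window_def by blast
    moreover have "transit y t0 (Suc m) \<zeta> = z" using False by (auto simp: switch_def t_def z_def)
    ultimately show ?thesis by simp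
  qed
  finally show ?case by (simp add: t_def add.commute add.left_commute)
qed

lemma recurrent_zero_before:
  assumes "recurrent y" "y T = 0"
  shows "\<exists>t\<le>s. y t = 0"
proof -
  obtain p where p: "p > 0" "\<And>t m. y (t + m * p) = y t" using assms(1) by (auto simp: recurrent_def)
  \<comment> \<open>Since \<open>p \<ge> 1\<close>, going back \<open>\<bar>s - T\<bar>\<close>
    periods from the zero \<open>T\<close> reaches a zero no later than \<open>s\<close>.\<close>
  have "\<bar>s - T\<bar> * 1 \<le> \<bar>s - T\<bar> * p" using p(1) by (intro mult_left_mono) auto
  then have "T + - \<bar>s - T\<bar> * p \<le> s" by simp
  moreover have "y (T + - \<bar>s - T\<bar> * p) = 0" by (simp only: p(2) assms(2))
  ultimately show ?thesis by blast
qed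

lemma recurrent_zero_after:
  assumes "recurrent y" "y T = 0"
  shows "\<exists>t\<ge>s. y t = 0"
proof -
  obtain p where p: "p > 0" "\<And>t m. y (t + m * p) = y t" using assms(1) by (auto simp: recurrent_def)
  have "\<bar>s - T\<bar> * 1 \<le> \<bar>s - T\<bar> * p" using p(1) by (intro mult_left_mono) auto
  then have "T + \<bar>s - T\<bar> * p \<ge> s" by simp
  moreover have "y (T + \<bar>s - T\<bar> * p) = 0" using p(2) assms(2) by simp
  ultimately show ?thesis by blast
qed

section \<open>Paths arriving from infinity\<close>

definition excursion_bound :: "nat \<Rightarrow> bool" where
  "excursion_bound N \<longleftrightarrow> (\<forall>y t t1 t2. ray_path y \<longrightarrow> y t1 = 0 \<longrightarrow> y t2 = 0 \<longrightarrow> t1 \<le> t \<longrightarrow> t \<le> t2 \<longrightarrow> y t \<le> N)"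

lemma excursion_boundD:
  "excursion_bound N \<Longrightarrow> ray_path y \<Longrightarrow> y t1 = 0 \<Longrightarrow> y t2 = 0 \<Longrightarrow> t1 \<le> t \<Longrightarrow> t \<le> t2 \<Longrightarrow> y t \<le> N"
  by (simp add: excursion_bound_def)

text \<open>A path that is not recurrent leaves every bounded set in both time directions, so if it
  meets the origin it has a first visit \<open>T\<close>. The residue of \<open>T\<close> modulo
  \<open>n\<close> serves as a label of the path.\<close>

definition arrival :: "(int \<Rightarrow> nat) \<Rightarrow> int \<Rightarrow> bool" where
  "arrival y T \<longleftrightarrow> ray_path y \<and> \<not> recurrent y \<and> y T = 0 \<and> (\<forall>t<T. y t \<noteq> 0)"

text \<open>The path \<open>x\<close> comes from infinity and reaches the origin, so it crosses the double ray around
  place \<open>M\<close>; the path \<open>y\<close> that it follows there does not return to the sheet it started from.\<close>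
lemma crossing:
  assumes bound: "excursion_bound N" and win: "window (Suc N) U"
    and M: "even M" "M > N + 3" and U: "walk M \<xi> \<in> U"
    and x: "ray_path x" "\<not> recurrent x" "x i = 0"
  shows "\<exists>y T k0. arrival y T \<and> x T = M \<and> (\<forall>k\<ge>k0. transit y T k (walk M \<xi>) \<noteq> walk M \<xi>)"
proof -
  \<comment> \<open>Place \<open>R\<close> of the ray is place \<open>Suc N\<close>, just above the
    excursion bound, of the outward walk from \<open>walk M \<xi>\<close>.\<close>
  define R where "R = M + Suc N"
  have "finite {t. x t \<le> R}" using recurrent_or_proper[OF x(1)] x(2) by blast
  define s where "s = Min {t. x t \<le> R} - 1"
  have "Min {t. x t \<le> R} \<le> i" by (rule Min_le[OF \<open>finite _\<close>]) (simp add: x(3))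
  then have "s < i" by (simp add: s_def)
  have "\<not> x s \<le> R"
    using \<open>finite _\<close> Min_le[of "{t. x t \<le> R}" s] by (auto simp: s_def)
  \<comment> \<open>The last time before \<open>i\<close> at which \<open>x\<close> is not below
    \<open>R\<close>; afterwards \<open>x\<close> cannot escape outward.\<close>
  define t1 where "t1 = Max {t \<in> {s..i}. x t \<ge> R}"
  have fin: "finite {t \<in> {s..i}. x t \<ge> R}" by (rule finite_subset[of _ "{s..i}"]) auto
  have "t1 \<in> {t \<in> {s..i}. x t \<ge> R}" unfolding t1_def
  proof (rule Max_in[OF fin])
    have "s \<in> {t \<in> {s..i}. x t \<ge> R}" using \<open>s < i\<close> \<open>\<not> x s \<le> R\<close> by simp
    then show "{t \<in> {s..i}. x t \<ge> R} \<noteq> {}" by blast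
  qed
  then have t1: "s \<le> t1" "t1 \<le> i" "x t1 \<ge> R" by auto
  have inside: "x t < R" if "t1 < t" "t \<le> i" for t
  proof (rule ccontr)
    assume "\<not> x t < R"
    then have "t \<le> t1" unfolding t1_def
      by (intro Max_ge[OF fin]) (use that t1 in auto)
    then show False using that by simp
  qed
  have "t1 < i" using t1(2,3) x(3) by (cases "t1 = i") (auto simp: R_def)
  then have "x t1 = R"
    using inside[of "t1 + 1"] t1(3) ray_path_step(2)[OF x(1), of t1] by simp
  \<comment> \<open>\<open>y\<close> describes \<open>x\<close> in the coordinates of the double ray
    around place \<open>M\<close>.\<close>
  obtain y where y: "ray_path y" "y t1 = Suc N" using ray_path_exists by blast
  have lift: "walk (x (t1 + int m)) \<xi> = walk (y (t1 + int m)) (transit y t1 m (walk M \<xi>))"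
    if "\<And>j. j < m \<Longrightarrow> y (t1 + int j) \<le> Suc N" for m
  proof (rule lift_path[OF win U y(1)])
    show "walk (x (t + 1)) \<xi> = v t (walk (x t) \<xi>)" for t
      using x(1) by (simp add: ray_path_def step_props(1))
    show "walk (x t1) \<xi> = walk (y t1) (walk M \<xi>)"
      using \<open>x t1 = R\<close> y(2) walk_add[OF M(1)] by (simp only: R_def)
  qed (rule that)
  have sheet: "transit y t1 m (walk M \<xi>) = walk M \<xi> \<or> transit y t1 m (walk M \<xi>) = a (walk M \<xi>)" for m
    by (rule A_cases[OF transit_A])
  \<comment> \<open>Otherwise \<open>x\<close> would still be on this double ray at time
    \<open>i\<close>, at place \<open>M + y i\<close> or \<open>M - 1 - y i\<close>. Both are
    positive because \<open>M > N + 3\<close>, whereas \<open>x i = 0\<close>.\<close>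
  have "\<exists>m. t1 + int m \<le> i \<and> y (t1 + int m) > Suc N"
  proof (rule ccontr)
    assume none: "\<not> ?thesis"
    define m where "m = nat (i - t1)"
    have m: "t1 + int m = i" using \<open>t1 < i\<close> by (simp add: m_def)
    have small: "y (t1 + int j) \<le> Suc N" if "j \<le> m" for j
    proof -
      have "t1 + int j \<le> i" using that m by simp
      then show ?thesis using none by (metis not_less)
    qed
    have "walk 0 \<xi> = walk (y i) (transit y t1 m (walk M \<xi>))"
      using lift[of m] small x(3) m by simp
    moreover have yi: "y i \<le> Suc N" using small[of m] m by simp
    ultimately have "walk 0 \<xi> = walk (M + y i) \<xi> \<or> walk 0 \<xi> = walk (M - 1 - y i) \<xi>"
      using sheet[of m] walk_add[OF M(1), of "y i" \<xi>] walk_a_diff[OF M(1), of "y i" \<xi>] M(2)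
      by (elim disjE) simp_all
    then show False using yi M(2) by (simp only: walk_xi_eq_iff) auto
  qed
  then obtain m' where m': "t1 + int m' \<le> i" "y (t1 + int m') > Suc N" by blast
  define m where "m = (LEAST m. y (t1 + int m) > Suc N)"
  have ym: "y (t1 + int m) > Suc N" unfolding m_def by (rule LeastI) (rule m'(2))
  have before_m: "y (t1 + int j) \<le> Suc N" if "j < m" for j
    using not_less_Least[of j "\<lambda>m. y (t1 + int m) > Suc N"] that unfolding m_def by simp
  have "m \<le> m'" unfolding m_def by (rule Least_le) (rule m'(2))
  then have m_le: "t1 + int m \<le> i" using m'(1) by simp
  have "m \<noteq> 0" using ym y(2) by (intro notI) simp
  then obtain m1 where m1: "m = Suc m1" by (cases m) auto
  have "y (t1 + int m) = Suc (Suc N)"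
    using before_m[of m1] ym ray_path_step(1)[OF y(1), of "t1 + int m1"] m1 by (simp add: algebra_simps)
  define h where "h = transit y t1 m"
  \<comment> \<open>If \<open>h\<close> fixed the base point, \<open>x\<close> would leave through
    the outward sheet, at a place beyond \<open>R\<close>.\<close>
  have h: "h (walk M \<xi>) \<noteq> walk M \<xi>"
  proof
    assume "h (walk M \<xi>) = walk M \<xi>"
    then have "walk (x (t1 + int m)) \<xi> = walk (M + Suc (Suc N)) \<xi>"
      using lift[OF before_m] \<open>y (t1 + int m) = _\<close> walk_add[OF M(1)] unfolding h_def by metis
    then show False using inside[of "t1 + int m"] m_le \<open>m \<noteq> 0\<close> by (simp add: R_def)
  qed
  have "\<exists>j<m. y (t1 + int j) = 0"
  proof (rule ccontr)
    assume none: "\<not> ?thesis"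
    have "transit y t1 m = id" by (rule transit_id) (use none in simp)
    then show False using h unfolding h_def by simp
  qed
  then obtain k' where k': "k' < m" "y (t1 + int k') = 0" by (elim exE conjE)
  define k where "k = (LEAST j. y (t1 + int j) = 0)"
  have yk: "y (t1 + int k) = 0" unfolding k_def by (rule LeastI) (rule k'(2))
  have before_k: "y (t1 + int j) \<noteq> 0" if "j < k" for j
    using not_less_Least[of j "\<lambda>j. y (t1 + int j) = 0"] that unfolding k_def by simp
  have "k \<le> k'" unfolding k_def by (rule Least_le) (rule k'(2))
  then have "k < m" using k'(1) by simp
  define T where "T = t1 + int k"
  \<comment> \<open>Between two zeros the values are at most \<open>N\<close>, but \<open>y\<close>
    exceeds \<open>N\<close> at \<open>t1\<close> and at \<open>t1 + int m\<close>. So all zeros lie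
    strictly between these times.\<close>
  have no_zero_before: "y t \<noteq> 0" if "t \<le> t1" for t
    using excursion_boundD[OF bound y(1) _ yk that] y(2) by auto
  have no_zero_after: "y t \<noteq> 0" if "t \<ge> t1 + int m" for t
    using excursion_boundD[OF bound y(1) yk _ _ that] ym \<open>k < m\<close> by auto
  have first: "y t \<noteq> 0" if "t < T" for t
  proof (cases "t \<le> t1")
    case False
    then have "y (t1 + int (nat (t - t1))) \<noteq> 0"
      using that by (intro before_k) (simp add: T_def nat_less_iff)
    then show ?thesis using False by simp
  qed (rule no_zero_before)
  have "y T = 0" using yk by (simp add: T_def)
  have "\<not> recurrent y"
  proof
    assume "recurrent y"
    then obtain t where "t \<le> T - 1" "y t = 0"
      using recurrent_zero_before[of y T "T - 1"] \<open>y T = 0\<close> by blast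
    then show False using first[of t] by simp
  qed
  have tk: "transit y t1 k = id" by (rule transit_id) (rule before_k)
  have "walk (x T) \<xi> = walk (y T) (transit y t1 k (walk M \<xi>))"
    unfolding T_def using before_m \<open>k < m\<close> by (intro lift) simp
  then have "x T = M" using tk \<open>y T = 0\<close> by simp
  \<comment> \<open>After time \<open>t1 + int m\<close> the origin is never read again, so the
    product stays equal to \<open>h\<close>.\<close>
  have "transit y T k1 (walk M \<xi>) \<noteq> walk M \<xi>" if "k1 \<ge> m - k" for k1
  proof -
    define r where "r = k1 - (m - k)"
    have "transit y (t1 + int m) r = id"
      by (rule transit_id) (rule no_zero_after, simp)
    moreover have "T + int (m - k) = t1 + int m" using \<open>k < m\<close> by (simp add: T_def)
    ultimately have "transit y T k1 = transit y T (m - k)"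
      using transit_add[of y T "m - k" r] that by (simp add: r_def)
    also have "\<dots> = h"
      using transit_add[of y t1 k "m - k"] tk \<open>k < m\<close> by (simp add: h_def T_def)
    finally show ?thesis using h by simp
  qed
  then show ?thesis
    using y(1) \<open>\<not> recurrent y\<close> \<open>y T = 0\<close> first \<open>x T = M\<close> unfolding arrival_def by blast
qed

text \<open>The label thus determines an arriving path up to a shift by a multiple of
  \<open>n\<close>.\<close>

lemma arrival_congruent:
  assumes "arrival y T" "arrival y' T'" "T mod n = T' mod n"
  shows "\<exists>m. T' = T + m * n \<and> y = (\<lambda>t. y' (t + m * n))"
proof -
  have "n dvd T' - T" using assms(3) by (metis mod_eq_dvd_iff)
  then obtain m where m: "T' = T + m * n" by (metis add.commute diff_add_cancel dvdE mult.commute)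
  have "y = (\<lambda>t. y' (t + m * n))"
    by (rule ray_path_unique[of _ _ T]) (use assms m ray_path_shift in \<open>auto simp: arrival_def\<close>)
  with m show ?thesis by blast
qed

text \<open>Two paths that agree at congruent times are shifts of each other, and a shift carries
  first visit to first visit. This yields injectivity of the crossing map.\<close>

lemma arrival_unique_mod:
  assumes "arrival x T" "arrival x' T'" "x s = x' s'" "s mod n = s' mod n"
  shows "T mod n = T' mod n"
proof -
  have "n dvd s' - s" using assms(4) by (metis mod_eq_dvd_iff)
  then obtain m where m: "s' = s + m * n" by (metis add.commute diff_add_cancel dvdE mult.commute)
  have eq: "x = (\<lambda>t. x' (t + m * n))"
    by (rule ray_path_unique[of _ _ s]) (use assms m ray_path_shift in \<open>auto simp: arrival_def\<close>)
  have "x' (T + m * n) = 0" using assms(1) eq by (metis arrival_def)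
  then have "\<not> T + m * n < T'" using assms(2) by (auto simp: arrival_def)
  moreover have "x (T' - m * n) = 0" using assms(2) by (simp add: eq arrival_def)
  then have "\<not> T' - m * n < T" using assms(1) by (auto simp: arrival_def)
  ultimately have "T' = T + m * n" by simp
  then show ?thesis by simp
qed

lemma transit_eventually:
  assumes "ray_path y" "\<not> recurrent y"
  shows "\<exists>c\<in>A. \<exists>k0. \<forall>k\<ge>k0. transit y T k = c"
proof -
  define Z where "Z = {t. y t \<le> 0}"
  have "finite Z" using recurrent_or_proper[OF assms(1), of 0] assms(2) by (simp add: Z_def)
  \<comment> \<open>One step past the last visit to the origin; inserting \<open>T\<close> keeps the
    maximum defined and at least \<open>T\<close>.\<close>
  define k0 where "k0 = nat (Max (insert T Z) - T + 1)"
  have k0: "T + int k0 = Max (insert T Z) + 1"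
    using \<open>finite Z\<close> Max_ge[of "insert T Z" T] by (simp add: k0_def)
  have "y t \<noteq> 0" if "t \<ge> T + int k0" for t
  proof
    assume "y t = 0"
    then have "t \<le> Max (insert T Z)" using \<open>finite Z\<close> by (intro Max_ge) (auto simp: Z_def)
    then show False using that k0 by simp
  qed
  then have "transit y (T + int k0) r = id" for r by (intro transit_id) simp
  then have "transit y T (k0 + r) = transit y T k0" for r by (simp only: transit_add id_o)
  then have "\<forall>k\<ge>k0. transit y T k = transit y T k0" by (metis le_add_diff_inverse)
  then show ?thesis using transit_A by blast
qed

text \<open>The fixed points of \<open>c\<close> have interior inside \<open>U\<close>, and the
  dense walk from the far even place \<open>2 * Suc L\<close> meets it. If the place found is odd,
  the next one is its \<open>a\<close>-image, which is still in \<open>U\<close> and still fixed by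
  \<open>c\<close>.\<close>

lemma fixed_window_point:
  assumes "window N U" "c \<in> A"
  shows "\<exists>M. even M \<and> M > L \<and> walk M \<xi> \<in> U \<and> c (walk M \<xi>) = walk M \<xi>"
proof -
  define V where "V = U \<inter> interior {x. c x = x}"
  have "open U" "\<xi> \<in> U" using assms(1) by (auto simp: window_def)
  then have "V \<noteq> {}" "open V"
    using accumulates[OF assms(2)] unfolding islimpt_def V_def by blast+
  then obtain k where "walk k (walk (2 * Suc L) \<xi>) \<in> V" using walk_meets by blast
  then have k: "walk (2 * Suc L + k) \<xi> \<in> V" by (simp only: walk_add[of "2 * Suc L" k \<xi>] even_mult_iff even_numeral simp_thms)
  define M where "M = 2 * Suc L + k"
  have M: "walk M \<xi> \<in> U" "c (walk M \<xi>) = walk M \<xi>" "M > L"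
    using k interior_subset[of "{x. c x = x}"] by (auto simp: M_def V_def)
  show ?thesis
  proof (cases "even M")
    case True
    with M show ?thesis by blast
  next
    case False
    then have "walk (Suc M) \<xi> = a (walk M \<xi>)" by (simp add: walk.simps(2) gen_def)
    moreover have "a (walk M \<xi>) \<in> U" by (rule window_a[OF assms(1) M(1)])
    moreover have "c (a (walk M \<xi>)) = a (walk M \<xi>)" by (rule A_fixes_a[OF assms(2) M(2)])
    moreover have "even (Suc M)" "Suc M > L" using False M(3) by simp_all
    ultimately show ?thesis by metis
  qed
qed

lemma ray_path_recurrent:
  assumes "ray_path y0" "y0 t0 = 0"
  shows "recurrent y0"
proof (rule ccontr)
  assume "\<not> recurrent y0"
  define Z where "Z = {t. y0 t \<le> 0}"
  have "finite Z" using recurrent_or_proper[OF assms(1), of 0] \<open>\<not> recurrent y0\<close> by (simp add: Z_def)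
  moreover have "t0 \<in> Z" using assms(2) by (simp add: Z_def)
  ultimately have "Min Z \<in> Z" by (intro Min_in) auto
  define T0 where "T0 = Min Z"
  have "y0 t \<noteq> 0" if "t < T0" for t
    using that Min_le[OF \<open>finite Z\<close>, of t] by (auto simp: T0_def Z_def)
  then have arr0: "arrival y0 T0"
    using \<open>Min Z \<in> Z\<close> assms(1) \<open>\<not> recurrent y0\<close> by (simp add: arrival_def T0_def Z_def)
  \<comment> \<open>\<open>c\<close> is the total sheet change produced by \<open>y0\<close>; the
    place \<open>M\<close> below is chosen to be fixed by it.\<close>
  obtain c k0 where c: "c \<in> A" "\<And>k. k \<ge> k0 \<Longrightarrow> transit y0 T0 k = c"
    using transit_eventually[OF assms(1) \<open>\<not> recurrent y0\<close>] by metis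
  obtain N where N: "excursion_bound N" using bounded_excursions unfolding excursion_bound_def ..
  obtain U where U: "window (Suc N) U" using window_exists by blast
  obtain M where M: "even M" "M > N + 3" "walk M \<xi> \<in> U" "c (walk M \<xi>) = walk M \<xi>"
    using fixed_window_point[OF U c(1), of "N + 3"] by blast
  define I where "I = {T mod n | y T. arrival y T}"
  have "I \<subseteq> {0..<n}" using n_pos by (auto simp: I_def)
  then have "finite I" by (rule finite_subset) simp
  \<comment> \<open>The crossing relation between labels. \<open>crossing\<close> gives every label
    a successor; the map is injective because \<open>x\<close> is at place \<open>M\<close> at the
    first visit time of \<open>y\<close>, which determines the label of \<open>x\<close>.\<close>
  define rel where "rel i j \<longleftrightarrow> (\<exists>x T y S k0. arrival x T \<and> T mod n = i \<and> arrival y S \<and> S mod n = j \<and> x S = M \<and>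
      (\<forall>k\<ge>k0. transit y S k (walk M \<xi>) \<noteq> walk M \<xi>))" for i j
  have "\<exists>j. rel i j" if i: "i \<in> I" for i
  proof -
    obtain x T where x: "arrival x T" "T mod n = i" using i by (auto simp: I_def)
    then show ?thesis
      using crossing[OF N U M(1,2,3), of x T] unfolding rel_def by (metis arrival_def)
  qed
  then obtain f where f: "\<And>i. i \<in> I \<Longrightarrow> rel i (f i)" by metis
  have "f ` I \<subseteq> I" using f by (force simp: rel_def I_def)
  moreover have "inj_on f I"
  proof (rule inj_onI)
    fix i j
    assume "i \<in> I" "j \<in> I" "f i = f j"
    then have "rel i (f i)" "rel j (f i)" using f[of i] f[of j] by simp_all
    then obtain x T S x' T' S' where "arrival x T" "T mod n = i" "S mod n = f i" "x S = M"
      "arrival x' T'" "T' mod n = j" "S' mod n = f i" "x' S' = M"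
      unfolding rel_def by metis
    then show "i = j" using arrival_unique_mod[of x T x' T' S S'] by simp
  qed
  ultimately have "f ` I = I" using \<open>finite I\<close> by (intro endo_inj_surj)
  moreover have "T0 mod n \<in> I" using arr0 by (auto simp: I_def)
  ultimately obtain i where "i \<in> I" "f i = T0 mod n" by (metis imageE)
  then have "rel i (T0 mod n)" using f[of i] by simp
  then obtain y S k1 where y: "arrival y S" "S mod n = T0 mod n"
    "\<And>k. k \<ge> k1 \<Longrightarrow> transit y S k (walk M \<xi>) \<noteq> walk M \<xi>"
    unfolding rel_def by metis
  \<comment> \<open>Having the label of \<open>y0\<close>, the path \<open>y\<close> is a shift of
    \<open>y0\<close>, so its total sheet change is \<open>c\<close>. It would have to move the
    point at \<open>M\<close>, which \<open>c\<close> fixes.\<close>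
  obtain m where m: "T0 = S + m * n" "y = (\<lambda>t. y0 (t + m * n))"
    using arrival_congruent[OF y(1) arr0 y(2)] by blast
  have "transit y S (max k0 k1) = transit y0 T0 (max k0 k1)"
    by (simp only: m transit_shift)
  then show False using y(3)[of "max k0 k1"] c(2)[of "max k0 k1"] M(4) by simp
qed

subsection \<open>Orbits are uniformly bounded\<close>

definition segment :: "nat \<Rightarrow> 'a \<Rightarrow> 'a set" where
  "segment R z = (\<lambda>(k, w). walk k w) ` ({..R} \<times> {z, a z})"

lemma finite_segment: "finite (segment R z)"
  by (simp add: segment_def)

lemma card_segment: "card (segment R z) \<le> 2 * (R + 1)"
proof -
  have "card (segment R z) \<le> card ({..R} \<times> {z, a z})"
    unfolding segment_def by (rule card_image_le) simp
  also have "\<dots> = (R + 1) * card {z, a z}" by (simp add: card_cartesian_product)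
  also have "\<dots> \<le> (R + 1) * 2" by (intro mult_le_mono2) (simp add: card_insert_if)
  finally show ?thesis by simp
qed

lemma walk_in_segment: "k \<le> R \<Longrightarrow> w \<in> {z, a z} \<Longrightarrow> walk k w \<in> segment R z"
  unfolding segment_def by (rule image_eqI[of _ _ "(k, w)"]) auto

text \<open>The orbit follows the path that is at the origin at time \<open>t0\<close>. This path is
  recurrent, so every time lies between two of its zeros, its values never exceed \<open>N\<close>,
  and the orbit never leaves the window.\<close>

lemma confined_by_reflection:
  assumes bound: "excursion_bound N" and win: "window N U"
    and x: "\<And>t. t \<ge> t0 \<Longrightarrow> x (t + 1) = v t (x t)" "x t0 \<in> U" and "t \<ge> t0"
  shows "x t \<in> segment N (x t0)"
proof -
  obtain y where y: "ray_path y" "y t0 = 0" using ray_path_exists by blast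
  have rec: "recurrent y" by (rule ray_path_recurrent[OF y])
  have small: "y s \<le> N" for s
  proof -
    obtain t1 t2 where "t1 \<le> s" "y t1 = 0" "s \<le> t2" "y t2 = 0"
      using recurrent_zero_before[OF rec y(2), of s] recurrent_zero_after[OF rec y(2), of s] by metis
    then show ?thesis using excursion_boundD[OF bound y(1)] by metis
  qed
  have "x (t0 + int m) = walk (y (t0 + int m)) (transit y t0 m (x t0))" for m
    by (rule lift_path[OF win x(2) y(1) x(1)]) (use y(2) small in simp_all)
  moreover have "transit y t0 m (x t0) \<in> {x t0, a (x t0)}" for m
    using A_cases[OF transit_A] by simp
  ultimately have "x (t0 + int m) \<in> segment N (x t0)" for m
    using walk_in_segment small by metis
  from this[of "nat (t - t0)"] show ?thesis using \<open>t \<ge> t0\<close> by simp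
qed

text \<open>On both walks, from \<open>z\<close> and from \<open>a z\<close>, a point of
  \<open>U\<close> occurs within \<open>K\<close> places. A letter moves by at most one place, so an
  orbit avoiding \<open>U\<close> cannot pass these two barriers.\<close>

lemma confined_between_markers:
  assumes win: "window N U" and K: "\<And>z. \<exists>k\<le>K. walk k z \<in> U"
    and x: "\<And>t. t \<ge> t0 \<Longrightarrow> x (t + 1) = v t (x t)" "\<And>t. t \<ge> t0 \<Longrightarrow> x t \<notin> U" and "t \<ge> t0"
  shows "x t \<in> segment K (x t0)"
proof -
  define z where "z = x t0"
  define L where "L w = (LEAST k. walk k w \<in> U)" for w
  have L: "walk (L w) w \<in> U" "L w \<le> K" for w
  proof -
    obtain k where k: "k \<le> K" "walk k w \<in> U" using K by blast
    then show "walk (L w) w \<in> U" unfolding L_def by (intro LeastI)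
    have "L w \<le> k" unfolding L_def by (rule Least_le) (rule k(2))
    with k show "L w \<le> K" by simp
  qed
  \<comment> \<open>Invariance of \<open>U\<close> under \<open>a\<close> places both origins off
    the barriers, so exchanging the two walks at place \<open>0\<close> is harmless.\<close>
  have "z \<notin> U" using x(2)[of t0] by (simp add: z_def)
  moreover from this have "a z \<notin> U" using window_a[OF win, of "a z"] by auto
  ultimately have L_pos: "L w > 0" if "w \<in> {z, a z}" for w
    using L(1)[of w] that by (cases "L w = 0") auto
  have inv: "\<exists>k w. k < L w \<and> w \<in> {z, a z} \<and> x (t0 + int m) = walk k w" for m
  proof (induction m)
    case 0
    then show ?case using L_pos[of z] by (intro exI[of _ 0] exI[of _ z]) (simp add: z_def)
  next
    case (Suc m)
    then obtain k w where kw: "k < L w" "w \<in> {z, a z}" "x (t0 + int m) = walk k w" by blast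
    define s where "s = v (t0 + int m)"
    have next_x: "x (t0 + int (Suc m)) = s (walk k w)"
      using x(1)[of "t0 + int m"] kw(3) by (simp add: s_def algebra_simps)
    obtain c where c: "c \<in> {a, b}" "s (walk k w) = walk k w \<or> s (walk k w) = c (walk k w)"
      using letter_cases[OF letters, of "t0 + int m"] unfolding s_def by blast
    from c(2) show ?case
    proof
      assume "s (walk k w) = walk k w"
      then show ?thesis using kw next_x by metis
    next
      assume s: "s (walk k w) = c (walk k w)"
      show ?thesis
      proof (cases "k > 0 \<or> c = b")
        case True
        then obtain l where l: "l = Suc k \<or> k = Suc l" "c (walk k w) = walk l w"
          using walk_neighbour[OF c(1)] by metis
        have "x (t0 + int (Suc m)) \<notin> U" by (rule x(2)) simp
        then have "l \<noteq> L w" using L(1)[of w] next_x s l(2) by metis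
        then have "l < L w" using l(1) kw(1) by auto
        then show ?thesis using kw(2) next_x s l(2) by metis
      next
        case False
        then have "c = a" "k = 0" using c(1) by auto
        then have "x (t0 + int (Suc m)) = walk 0 (a w)" using next_x s by simp
        moreover have "a w \<in> {z, a z}" using kw(2) by auto
        ultimately show ?thesis using L_pos by metis
      qed
    qed
  qed
  obtain k w where "k < L w" "w \<in> {z, a z}" "x t = walk k w"
    using inv[of "nat (t - t0)"] \<open>t \<ge> t0\<close> by auto
  then show ?thesis using L(2)[of w] walk_in_segment[of k K w z] by (simp add: z_def)
qed

text \<open>An orbit either enters \<open>U\<close>, and is confined from then on, or avoids
  \<open>U\<close> and is confined from the start. The cardinality bound is the same for all
  orbits.\<close>

lemma confined:
  "\<exists>C. \<forall>x. (\<forall>t\<ge>0. x (t + 1) = v t (x t)) \<longrightarrow>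
    (\<exists>S t0. t0 \<ge> 0 \<and> finite S \<and> card S \<le> C \<and> (\<forall>t\<ge>t0. x t \<in> S))"
proof -
  obtain N where N: "excursion_bound N" using bounded_excursions unfolding excursion_bound_def ..
  obtain U where U: "window N U" using window_exists by blast
  then have "open U" "U \<noteq> {}" by (auto simp: window_def)
  then obtain K where K: "\<And>z. \<exists>k\<le>K. walk k z \<in> U" using walk_meets_bounded by metis
  define C where "C = 2 * (max N K + 1)"
  have card: "card (segment N z) \<le> C" "card (segment K z) \<le> C" for z
    using card_segment[of N z] card_segment[of K z] by (simp_all add: C_def)
  have "\<exists>S t0. t0 \<ge> 0 \<and> finite S \<and> card S \<le> C \<and> (\<forall>t\<ge>t0. x t \<in> S)"
    if x: "\<And>t. t \<ge> 0 \<Longrightarrow> x (t + 1) = v t (x t)" for x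
  proof (cases "\<exists>t0\<ge>0. x t0 \<in> U")
    case True
    then obtain t0 where t0: "t0 \<ge> 0" "x t0 \<in> U" by blast
    have "x t \<in> segment N (x t0)" if "t \<ge> t0" for t
      by (rule confined_by_reflection[where x = x and ?t0.0 = t0]) (use N U t0 x that in simp_all)
    then show ?thesis using t0(1) finite_segment card(1)
      by (intro exI[of _ "segment N (x t0)"] exI[of _ t0] conjI allI impI)
  next
    case False
    have "x t \<in> segment K (x 0)" if "t \<ge> 0" for t
      by (rule confined_between_markers[where x = x and ?t0.0 = 0 and U = U and N = N])
        (use U K x False that in auto)
    then show ?thesis using finite_segment card(2)
      by (intro exI[of _ "segment K (x 0)"] exI[of _ 0] conjI allI impI) simp_all
  qed
  then show ?thesis by blast
qed

section \<open>From bounded orbits to a uniform period\<close>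

fun run :: "nat \<Rightarrow> 'a \<Rightarrow> 'a" where
  "run 0 z = z"
| "run (Suc k) z = v (int k) (run k z)"

lemma run_add: "run (nat n * m + k) z = run k (run (nat n * m) z)"
proof (induction k)
  case (Suc k)
  have "v (int (nat n * m + k)) = v (int k)"
    using v_shift[of "int k" "int m"] n_pos by (simp add: algebra_simps)
  with Suc show ?case by simp
qed simp

lemma run_funpow: "run (nat n * m) z = (run (nat n) ^^ m) z"
proof (induction m)
  case (Suc m)
  then show ?case using run_add[of m "nat n" z] by (simp add: algebra_simps)
qed simp

lemma inj_run: "inj (run k)"
proof (induction k)
  case (Suc k)
  have "run (Suc k) = v (int k) \<circ> run k" by (rule ext) simp
  then show ?case using inj_compose[OF inj_letter[OF letters] Suc] by (simp only:)
next
  case 0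
  have "run 0 = id" by (rule ext) simp
  then show ?case by (simp only: inj_on_id)
qed

text \<open>Among \<open>C + 1\<close> late iterates of a point two coincide, and injectivity
  removes the initial delay. Every point thus has a period at most \<open>C\<close>, which divides
  \<open>fact C\<close>.\<close>

lemma run_periodic: "\<exists>m\<ge>1. run (nat n) ^^ m = id"
proof -
  define g where "g = run (nat n)"
  have inj_g: "inj (g ^^ k)" for k
    unfolding g_def by (rule inj_fn[OF inj_run])
  obtain C where C: "\<And>x. (\<forall>t\<ge>0. x (t + 1) = v t (x t)) \<Longrightarrow>
      \<exists>S t0. t0 \<ge> 0 \<and> finite S \<and> card S \<le> C \<and> (\<forall>t\<ge>t0. x t \<in> S)"
    using confined by metis
  have "(g ^^ fact C) z = z" for z
  proof -
    have "\<forall>t\<ge>0. run (nat (t + 1)) z = v t (run (nat t) z)"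
      by (simp add: nat_add_distrib)
    from C[OF this] obtain S t0 where S: "t0 \<ge> 0" "finite S" "card S \<le> C" "\<And>t. t \<ge> t0 \<Longrightarrow> run (nat t) z \<in> S"
      by metis
    define k where "k = nat t0"
    have "(g ^^ (k + j)) z \<in> S" for j
    proof -
      \<comment> \<open>As \<open>n \<ge> 1\<close>, all iterates from the \<open>k\<close>-th on
        occur after time \<open>t0\<close>, when the orbit is already confined.\<close>
      have "1 * t0 \<le> n * int (k + j)"
        using n_pos S(1) by (intro mult_mono) (auto simp: k_def)
      then have "run (nat (n * int (k + j))) z \<in> S" using S(4) by simp
      moreover have "nat (n * int (k + j)) = nat n * (k + j)"
        using n_pos by (simp add: nat_mult_distrib)
      ultimately show ?thesis by (simp add: run_funpow g_def)
    qed
    then have "(\<lambda>j. (g ^^ (k + j)) z) ` {..C} \<subseteq> S" by blast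
    then have "\<not> inj_on (\<lambda>j. (g ^^ (k + j)) z) {..C}"
      using card_inj_on_le[OF _ _ S(2), of _ "{..C}"] S(3) by (metis card_atMost not_less_eq_eq order_trans)
    then obtain i' j' where "i' \<le> C" "j' \<le> C" "i' \<noteq> j'" "(g ^^ (k + i')) z = (g ^^ (k + j')) z"
      unfolding inj_on_def by blast
    then obtain i j where ij: "i < j" "j \<le> C" "(g ^^ (k + i)) z = (g ^^ (k + j)) z"
      by (metis nat_neq_iff)
    define d where "d = j - i"
    have "(g ^^ (k + i)) ((g ^^ d) z) = (g ^^ (k + i + d)) z" by (simp add: funpow_add)
    also have "k + i + d = k + j" using ij(1) by (simp add: d_def)
    finally have "(g ^^ (k + i)) ((g ^^ d) z) = (g ^^ (k + i)) z" using ij(3) by simp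
    then have "(g ^^ d) z = z" by (rule injD[OF inj_g])
    then have "((g ^^ d) ^^ q) z = z" for q by (induction q) simp_all
    moreover have "d dvd fact C" using ij by (intro dvd_fact) (auto simp: d_def)
    then obtain q where "fact C = d * q" ..
    ultimately show ?thesis
      by (simp add: funpow_mult)
  qed
  then have "g ^^ fact C = id" by (simp add: fun_eq_iff)
  moreover have "fact C \<ge> (1 :: nat)" by simp
  ultimately show ?thesis unfolding g_def by blast
qed

end

subsection \<open>Homeomorphism groups of the Cantor set\<close>

lemma cantor_space_euclidean:
  assumes "cantor_space (euclidean :: 'a::topological_space topology)"
  shows "compact (UNIV :: 'a set)" "Hausdorff_space (euclidean :: 'a topology)"
    "infinite (UNIV :: 'a set)"
proof -
  let ?P = "product_topology (\<lambda>_::nat. discrete_topology (UNIV :: bool set)) UNIV"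
  have homeo: "(euclidean :: 'a topology) homeomorphic_space ?P"
    using assms by (simp only: cantor_space_def)
  have "compact_space ?P"
    unfolding compact_space_product_topology by (simp add: compact_space_discrete_topology)
  then have "compact_space (euclidean :: 'a topology)"
    using homeomorphic_compact_space[OF homeo] by simp
  then show "compact (UNIV :: 'a set)" by (simp add: compact_space_def)
  have "Hausdorff_space ?P"
    unfolding Hausdorff_space_product_topology by simp
  then show "Hausdorff_space (euclidean :: 'a topology)"
    using homeomorphic_Hausdorff_space[OF homeo] by simp
  obtain f where "homeomorphic_map (euclidean :: 'a topology) ?P f"
    using homeo by (auto simp: homeomorphic_space)
  then have surj: "f ` topspace (euclidean :: 'a topology) = topspace ?P"
    by (rule homeomorphic_imp_surjective_map)
  then have surj: "range f = (UNIV :: (nat \<Rightarrow> bool) set)" by simp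
  show "infinite (UNIV :: 'a set)"
  proof
    assume "finite (UNIV :: 'a set)"
    then have "finite (UNIV :: (nat \<Rightarrow> bool) set)"
      unfolding surj[symmetric] by (rule finite_imageI)
    then have "finite (UNIV :: nat set)" by (rule finite_fun_UNIVD1) simp
    then show False by simp
  qed
qed

lemma homeo_group_simps [simp]:
  "f \<otimes>\<^bsub>homeo_group\<^esub> g = f \<circ> g" "\<one>\<^bsub>homeo_group\<^esub> = id"
  by (simp_all only: homeo_group_def monoid.simps)

lemma homeo_groupD:
  assumes "f \<in> carrier homeo_group"
  shows "continuous_on UNIV f" "inj f"
proof -
  have f: "homeomorphic_map euclidean euclidean f" using assms by (simp add: homeo_group_def)
  show "continuous_on UNIV f" using homeomorphic_imp_continuous_map[OF f] by simp
  show "inj f" using homeomorphic_imp_injective_map[OF f] by simp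
qed

lemma invariant_under_generated:
  assumes "period_two a" "period_two b" "a ` C \<subseteq> C" "b ` C \<subseteq> C"
    and "g \<in> generate homeo_group {a, b}"
  shows "g ` C \<subseteq> C"
  using assms(5)
proof induction
  case one
  then show ?case by simp
next
  case (incl h)
  then show ?case using assms(3,4) by blast
next
  case (inv h)
  then have h: "period_two h" "h ` C \<subseteq> C" using assms(1-4) by auto
  then have "inv\<^bsub>homeo_group\<^esub> h = h"
    by (intro group.inv_equality[OF group_homeo_group]) (simp_all add: period_two_def)
  then show ?case using h(2) by simp
next
  case (eng h1 h2)
  then show ?case unfolding homeo_group_simps image_comp[symmetric] by blast
qed

text \<open>A closed invariant set contains the closure of the orbit of each of its points.\<close>

lemma minimal_closed_invariant:
  assumes "period_two a" "period_two b"
    and "minimal_homeo_action (subgroup_generated homeo_group {a, b})"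
    and "closed C" "C \<noteq> {}" "a ` C \<subseteq> C" "b ` C \<subseteq> C"
  shows "C = UNIV"
proof -
  let ?G = "subgroup_generated homeo_group {a, b}"
  obtain x where "x \<in> C" using assms(5) by blast
  have "carrier ?G = generate homeo_group {a, b}"
    using assms(1,2) by (simp add: carrier_subgroup_generated period_two_def)
  then have "orbit ?G (\<lambda>g. g) x \<subseteq> C"
    using invariant_under_generated[OF assms(1,2,6,7)] \<open>x \<in> C\<close> unfolding orbit_def by blast
  then have "closure (orbit ?G (\<lambda>g. g) x) \<subseteq> C" using assms(4) by (rule closure_minimal)
  then show ?thesis using assms(3) unfolding minimal_homeo_action_def by blast
qed

section \<open>Group elements as words, and the conclusion\<close>

lemma generate_word:
  assumes "subgroup A homeo_group" "subgroup B homeo_group" "g \<in> generate homeo_group (A \<union> B)"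
  shows "\<exists>l. set l \<subseteq> A \<union> B \<and> g = fold (\<lambda>s. s) l"
  using assms(3)
proof induction
  case one
  have "\<one>\<^bsub>homeo_group\<^esub> = fold (\<lambda>s. s) []" by (simp add: fun_eq_iff)
  then show ?case by (metis empty_subsetI list.set(1))
next
  case (incl h)
  have "h = fold (\<lambda>s. s) [h]" by (simp add: fun_eq_iff)
  moreover have "set [h] \<subseteq> A \<union> B" using incl by simp
  ultimately show ?case by blast
next
  case (inv h)
  define k where "k = inv\<^bsub>homeo_group\<^esub> h"
  \<comment> \<open>Both \<open>A\<close> and \<open>B\<close> are subgroups, so the inverse of a
    letter is again a letter.\<close>
  have "k \<in> A \<union> B"
    using inv subgroup.m_inv_closed[OF assms(1)] subgroup.m_inv_closed[OF assms(2)]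
    unfolding k_def by blast
  moreover have "k = fold (\<lambda>s. s) [k]" by (simp add: fun_eq_iff)
  ultimately show ?case unfolding k_def[symmetric]
    by (intro exI[of _ "[k]"]) simp
next
  case (eng h1 h2)
  then obtain l1 l2 where "set l1 \<subseteq> A \<union> B" "h1 = fold (\<lambda>s. s) l1" "set l2 \<subseteq> A \<union> B" "h2 = fold (\<lambda>s. s) l2"
    by blast
  \<comment> \<open>\<open>fold\<close> applies the head of the list first, so the factors appear in
    reverse order.\<close>
  then have "set (l2 @ l1) \<subseteq> A \<union> B" "h1 \<otimes>\<^bsub>homeo_group\<^esub> h2 = fold (\<lambda>s. s) (l2 @ l1)"
    by (simp_all only: set_append Un_subset_iff fold_append homeo_group_simps simp_thms)
  then show ?case by blast
qed

lemma fragmented_action_of_fragmentation: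
  fixes a b :: "'a::topological_space \<Rightarrow> 'a"
  assumes "cantor_space (euclidean :: 'a topology)" and "period_two a" "period_two b"
    and "minimal_homeo_action (subgroup_generated homeo_group {a, b})"
    and A: "fragmentation a A" and B: "fragmentation b B"
    and "a \<xi> = \<xi>"
    and "\<And>h. h \<in> A \<Longrightarrow> h \<xi> = \<xi> \<Longrightarrow> \<xi> islimpt interior {x. h x = x}"
  shows "fragmented_action a b A B \<xi>"
proof
  show "compact (UNIV :: 'a set)" "Hausdorff_space (euclidean :: 'a topology)" "infinite (UNIV :: 'a set)"
    using cantor_space_euclidean[OF assms(1)] by blast+
  show "continuous_on UNIV a" "continuous_on UNIV b"
    using assms(2,3) homeo_groupD(1) by (auto simp: period_two_def)
  show "a (a x) = x" "b (b x) = x" for x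
    using assms(2,3) by (simp_all add: period_two_def pointfree_idE)
  show "C = UNIV" if "closed C" "C \<noteq> {}" "a ` C \<subseteq> C" "b ` C \<subseteq> C" for C
    by (rule minimal_closed_invariant[OF assms(2-4) that])
  have subgroups: "subgroup A homeo_group" "subgroup B homeo_group"
    using A B by (simp_all add: fragmentation_def)
  show "finite A" "finite B" using A B by (simp_all add: fragmentation_def)
  show "id \<in> A" using subgroup.one_closed[OF subgroups(1)] by simp
  show "h \<circ> k \<in> A" if "h \<in> A" "k \<in> A" for h k
    using subgroup.m_closed[OF subgroups(1) that] by simp
  have "A \<union> B \<subseteq> carrier homeo_group" using subgroups[THEN subgroup.subset] by blast
  then show "continuous_on UNIV s" "inj s" if "s \<in> A \<union> B" for s
    using that homeo_groupD by blast+
  show "s z = z \<or> s z = a z" if "s \<in> A" for s z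
    using A that unfolding fragmentation_def by blast
  show "s z = z \<or> s z = b z" if "s \<in> B" for s z
    using B that unfolding fragmentation_def by blast
  show "\<exists>h\<in>A. h z = a z" for z using A unfolding fragmentation_def by blast
  show "a \<xi> = \<xi>" by (rule assms(7))
  show "\<xi> islimpt interior {x. h x = x}" if "h \<in> A" for h
  proof (rule assms(8)[OF that])
    show "h \<xi> = \<xi>" using A that assms(7) unfolding fragmentation_def by metis
  qed
qed

lemma (in fragmented_action) fold_letters_periodic:
  assumes "set l \<subseteq> A \<union> B"
  shows "\<exists>m\<ge>1. fold (\<lambda>s. s) l ^^ m = id"
proof (cases "l = []")
  case True
  then have "fold (\<lambda>s. s) l ^^ 1 = id" by (simp add: fun_eq_iff)
  then show ?thesis by blast
next
  case False
  \<comment> \<open>The periodic extension of the word to all integer times; one run through a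
    period recovers the given product.\<close>
  define v where "v t = l ! nat (t mod int (length l))" for t
  interpret fragmented_word a b A B \<xi> v "int (length l)"
  proof
    show "v t \<in> A \<union> B" for t
    proof -
      have "nat (t mod int (length l)) < length l" using False by (simp add: nat_less_iff)
      then show ?thesis using assms nth_mem unfolding v_def by blast
    qed
    show "v (t + int (length l)) = v t" for t by (simp add: v_def)
    show "int (length l) > 0" using False by simp
  qed
  have "run k z = fold (\<lambda>s. s) (take k l) z" if "k \<le> length l" for k z
    using that
  proof (induction k)
    case (Suc k)
    then have "v (int k) = l ! k" by (simp add: v_def)
    with Suc show ?case by (simp add: take_Suc_conv_app_nth)
  qed simp
  then have "run (length l) = fold (\<lambda>s. s) l" by (intro ext) simp
  then show ?thesis using run_periodic by simp
qed

theorem theorem1p1: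
  fixes a b :: "'a::topological_space \<Rightarrow> 'a"
    and A B :: "('a \<Rightarrow> 'a) set"
    and \<xi> :: 'a
  assumes "cantor_space (euclidean :: 'a topology)"
    and "period_two a" and "period_two b"
    and "subgroup_generated homeo_group {a, b} \<cong> infinite_dihedral"
    and "minimal_homeo_action (subgroup_generated homeo_group {a, b})"
    and "fragmentation a A" and "fragmentation b B"
    and "a \<xi> = \<xi>"
    and "\<And>h. h \<in> A \<Longrightarrow> h \<xi> = \<xi> \<Longrightarrow> \<xi> islimpt interior {x. h x = x}"
  shows "periodic_group (subgroup_generated homeo_group (A \<union> B))"
proof -
  let ?G = "subgroup_generated homeo_group (A \<union> B)"
  interpret fragmented_action a b A B \<xi>
    by (rule fragmented_action_of_fragmentation[OF assms(1-3,5-9)])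
  have subgroups: "subgroup A homeo_group" "subgroup B homeo_group"
    using assms(6,7) by (simp_all add: fragmentation_def)
  have "carrier homeo_group \<inter> (A \<union> B) = A \<union> B"
    using subgroups[THEN subgroup.subset] by blast
  then have carrier: "carrier ?G = generate homeo_group (A \<union> B)"
    by (simp add: carrier_subgroup_generated)
  have pow: "g [^]\<^bsub>?G\<^esub> m = g ^^ m" for g and m :: nat
  proof (induction m)
    case (Suc m)
    then show ?case
      by (simp only: nat_pow_Suc mult_subgroup_generated homeo_group_simps funpow_Suc_right)
  next
    case 0
    show ?case by (simp only: nat_pow_0 one_subgroup_generated homeo_group_simps funpow_0 funpow.simps)
  qed
  have "\<exists>m::nat. m \<ge> 1 \<and> g [^]\<^bsub>?G\<^esub> m = \<one>\<^bsub>?G\<^esub>" if "g \<in> carrier ?G" for g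
  proof -
    obtain l where "set l \<subseteq> A \<union> B" "g = fold (\<lambda>s. s) l"
      using generate_word[OF subgroups] \<open>g \<in> carrier ?G\<close> carrier by metis
    then obtain m where "m \<ge> 1" "g ^^ m = id" using fold_letters_periodic by metis
    then show ?thesis by (metis pow one_subgroup_generated homeo_group_simps(2))
  qed
  moreover have "group ?G" by (rule group.group_subgroup_generated[OF group_homeo_group])
  ultimately show ?thesis by (simp only: periodic_group_def) blast
qed

end
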